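(* Let $F$ be an ordered field with an integer part $I$, let $\alpha,\beta\in F$ be distinct irrationals with $\alpha,\beta>1$, and let $a,b,c,d\in I^{\geqslant 0}$. Then the following hold. (1) If $N_{\alpha}\cap N_{\beta}=\{0\}$ and $N_{\alpha}\cup N_{\beta}=I^{\geqslant 0}$, then $\alpha^{-1}+\beta^{-1}=1$. (2) If $a\alpha^{-1}+b\beta^{-1}=1$, then $N_{\alpha}\cap N_{\beta}=\{0\}$. (3) If $a(1-\alpha^{-1})+b(1-\beta^{-1})=1$, then $N_{\alpha}\cup N_{\beta}=I^{\geqslant 0}$. (4) If $a\alpha^{-1}+b(1-\beta^{-1})=1$, then $N_{\alpha}\subseteq N_{\beta}$. (5) If $a\alpha^{-1}+b\beta^{-1}=1$ and $c(1-\alpha^{-1})+d(1-\beta^{-1})=1$, then $a=b=c=d=1$ (and so $\alpha^{-1}+\beta^{-1}=1$).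
   Context: A subring $I$ of an ordered field $F$ is an integer part of $F$ if $I$ is discretely ordered (no $x\in I$ satisfies $0<x<1$) and for every $x\in F$ there is a (necessarily unique) $a\in I$ with $a\leqslant x<a+1$; this $a$ is denoted $\lfloor x\rfloor$. $I^{\geqslant 0}=\{x\in I: x\geqslant 0\}$. An element of $F$ is rational if it lies in the fraction field $\mathrm{Frac}(I)\subseteq F$, and irrational otherwise. For $\alpha\in F$ positive, $N_\alpha=\{\lfloor n\alpha\rfloor : n\in I^{\geqslant 0}\}$. *)

theory Defs
  imports Main
begin

definition is_subring :: "'a::ring_1 set \<Rightarrow> bool" where
  "is_subring R \<longleftrightarrow> 1 \<in> R \<and> (\<forall>x\<in>R. \<forall>y\<in>R. x - y \<in> R) \<and> (\<forall>x\<in>R. \<forall>y\<in>R. x * y \<in> R)"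

(* The ordered field F is the whole type 'a; it need not be Archimedean, so the library's
   floor function (class floor_ceiling) is not available. *)
definition integer_part :: "'a::linordered_field set \<Rightarrow> bool" where
  "integer_part I \<longleftrightarrow>
     is_subring I \<and>
     \<not> (\<exists>x\<in>I. 0 < x \<and> x < 1) \<and>
     (\<forall>x. \<exists>a\<in>I. a \<le> x \<and> x < a + 1)"

definition floor_in :: "'a::linordered_field set \<Rightarrow> 'a \<Rightarrow> 'a" where
  "floor_in I x = (THE a. a \<in> I \<and> a \<le> x \<and> x < a + 1)"

lemma integer_part_floor_unique:
  fixes I :: "'a::linordered_field set"
  assumes "integer_part I"
  shows "\<exists>!a. a \<in> I \<and> a \<le> x \<and> x < a + 1"
proof -
  have le: "u \<le> v"
    if u: "u \<in> I" "u \<le> x" and v: "v \<in> I" "x < v + 1" for u v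
  proof (rule ccontr)
    assume "\<not> u \<le> v"
    then have "0 < u - v" by simp
    moreover have "u - v < 1"
      using le_less_trans[OF u(2) v(2)] by (simp add: diff_less_eq add.commute)
    moreover have "u - v \<in> I"
      using assms u v unfolding integer_part_def is_subring_def by blast
    ultimately show False
      using assms unfolding integer_part_def by blast
  qed
  obtain a where "a \<in> I" "a \<le> x" "x < a + 1"
    using assms unfolding integer_part_def by blast
  then show ?thesis
    by (intro ex1I[of _ a]) (auto intro: antisym le)
qed

lemma floor_in:
  fixes I :: "'a::linordered_field set"
  assumes "integer_part I"
  shows "floor_in I x \<in> I" "floor_in I x \<le> x" "x < floor_in I x + 1"
  using theI'[OF integer_part_floor_unique[OF assms, of x]]
  unfolding floor_in_def by blast+

definition nonneg_part :: "'a::linordered_field set \<Rightarrow> 'a set" where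
  "nonneg_part I = {x \<in> I. 0 \<le> x}"

definition frac_field :: "'a::field set \<Rightarrow> 'a set" where
  "frac_field I = {p / q |p q. p \<in> I \<and> q \<in> I \<and> q \<noteq> 0}"

definition irrational_over :: "'a::field set \<Rightarrow> 'a \<Rightarrow> bool" where
  "irrational_over I x \<longleftrightarrow> x \<notin> frac_field I"

definition beatty_set :: "'a::linordered_field set \<Rightarrow> 'a \<Rightarrow> 'a set" where
  "beatty_set I \<alpha> = {floor_in I (n * \<alpha>) |n. n \<in> nonneg_part I}"

end

theory Submission imports Defs begin

text \<open>
  Write \<open>p = 1/\<alpha>\<close>. For irrational \<open>\<alpha> > 1\<close> a positive \<open>m \<in> I\<close> lies in \<open>N\<^sub>\<alpha>\<close> exactly if an element
  of \<open>I\<close> lies strictly between \<open>m p\<close> and \<open>(m + 1) p\<close>, and it lies outside \<open>N\<^sub>\<alpha>\<close> exactly if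
  the same holds with \<open>1 - p\<close> in place of \<open>p\<close>; lemmas \<open>beatty_hit\<close> and \<open>beatty_miss\<close> give the
  forward directions. So a violation of disjointness, covering or inclusion at some \<open>m\<close> always
  reads: \<open>m p + s \<in> I\<close> and \<open>m q + t \<in> I\<close> with \<open>0 < s < p\<close>, \<open>0 < t < q\<close>, where the respective
  hypothesis is \<open>a p + b q = 1\<close>. But then \<open>a s + b t\<close> is in \<open>I\<close> and strictly between \<open>0\<close> and \<open>1\<close>
  (lemma \<open>no_simultaneous_hit\<close>).

  If both the disjointness and the covering equation hold, then \<open>(a, b)\<close> and \<open>(c, d)\<close> are
  proportional, as otherwise Cramer's rule puts \<open>1/\<alpha>\<close> and \<open>1/\<beta>\<close> into \<open>Frac(I)\<close>; comparing the
  right-hand sides then leaves only coefficients equal to \<open>1\<close>.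

  For the claim that complementary sets have \<open>1/\<alpha> + 1/\<beta> = 1\<close>, density or counting arguments are
  unavailable, since \<open>I\<close> need not be Archimedean or satisfy any induction principle. But the
  disjointness and covering claims with \<open>a = b = 1\<close> show that the complement of \<open>N\<^sub>\<alpha>\<close> is \<open>N\<^sub>\<gamma>\<close>
  (up to \<open>0\<close>) for \<open>1/\<gamma> = 1 - 1/\<alpha>\<close>. Hence \<open>N\<^sub>\<beta> = N\<^sub>\<gamma>\<close>, and it remains to show that \<open>N\<^sub>\<gamma>\<close>
  determines \<open>\<gamma>\<close>. As \<open>1\<close> belongs to exactly one of \<open>N\<^sub>\<alpha>\<close>, \<open>N\<^sub>\<beta>\<close>, one may take \<open>\<alpha> < 2 \<le> \<beta>\<close>, so that
  \<open>\<beta>, \<gamma> \<ge> 2\<close>; for distinct slopes in this range, lemma \<open>beatty_set_less_neq\<close> finds by division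
  in \<open>I\<close> a single element that separates \<open>N\<^sub>\<beta>\<close> from \<open>N\<^sub>\<gamma>\<close>.
\<close>

section \<open>Arithmetic in an integer part\<close>

context
  fixes I :: "'a::linordered_field set"
  assumes ip: "integer_part I"
begin

lemma one_mem: "1 \<in> I"
  and diff_mem: "\<lbrakk>u \<in> I; v \<in> I\<rbrakk> \<Longrightarrow> u - v \<in> I"
  and mult_mem: "\<lbrakk>u \<in> I; v \<in> I\<rbrakk> \<Longrightarrow> u * v \<in> I"
  using ip unfolding integer_part_def is_subring_def by blast+

lemma zero_mem: "0 \<in> I"
  using diff_mem[OF one_mem one_mem] by simp

lemma add_mem: assumes "u \<in> I" "v \<in> I" shows "u + v \<in> I"
  using diff_mem[OF assms(1) diff_mem[OF zero_mem assms(2)]] by simp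

lemmas ring_mem = zero_mem one_mem add_mem diff_mem mult_mem

lemma discrete: "\<lbrakk>x \<in> I; 0 < x\<rbrakk> \<Longrightarrow> 1 \<le> x"
  using ip unfolding integer_part_def by (metis not_le)

lemma le_if_less_add_one:
  assumes "u \<in> I" "v \<in> I" "u < v + 1"
  shows "u \<le> v"
  using discrete[OF diff_mem[OF assms(1,2)]] assms(3) by (cases "u \<le> v") auto

lemma floor_in_unique:
  assumes "u \<in> I" "u \<le> x" "x < u + 1"
  shows "floor_in I x = u"
  using integer_part_floor_unique[OF ip, of x] floor_in[OF ip, of x] assms by blast

lemma mem_beatty_set_iff:
  "m \<in> beatty_set I \<alpha> \<longleftrightarrow> m \<in> I \<and> (\<exists>n\<in>I. 0 \<le> n \<and> m \<le> n * \<alpha> \<and> n * \<alpha> < m + 1)"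
proof
  assume "m \<in> beatty_set I \<alpha>"
  then obtain n where "m = floor_in I (n * \<alpha>)" "n \<in> I" "0 \<le> n"
    unfolding beatty_set_def nonneg_part_def by blast
  then show "m \<in> I \<and> (\<exists>n\<in>I. 0 \<le> n \<and> m \<le> n * \<alpha> \<and> n * \<alpha> < m + 1)"
    using floor_in[OF ip, of "n * \<alpha>"] by auto
next
  assume "m \<in> I \<and> (\<exists>n\<in>I. 0 \<le> n \<and> m \<le> n * \<alpha> \<and> n * \<alpha> < m + 1)"
  then obtain n where n: "n \<in> I" "0 \<le> n" and "floor_in I (n * \<alpha>) = m"
    using floor_in_unique by blast
  then show "m \<in> beatty_set I \<alpha>"
    unfolding beatty_set_def nonneg_part_def by blast
qed

lemma zero_mem_beatty_set: "0 \<in> beatty_set I \<alpha>"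
  unfolding mem_beatty_set_iff using zero_mem by (auto intro!: bexI[of _ 0])

lemma beatty_set_subset_nonneg_part:
  assumes "0 < \<alpha>"
  shows "beatty_set I \<alpha> \<subseteq> nonneg_part I"
proof
  fix m assume "m \<in> beatty_set I \<alpha>"
  then obtain n where n: "m \<in> I" "0 \<le> n" "n * \<alpha> < m + 1"
    unfolding mem_beatty_set_iff by blast
  have "0 < m + 1"
    using n assms by (meson le_less_trans less_imp_le mult_nonneg_nonneg)
  then show "m \<in> nonneg_part I"
    using le_if_less_add_one[OF zero_mem n(1)] n(1) by (simp add: nonneg_part_def)
qed

lemma one_mem_beatty_set_iff:
  assumes "1 < \<alpha>"
  shows "1 \<in> beatty_set I \<alpha> \<longleftrightarrow> \<alpha> < 2"
proof
  assume "1 \<in> beatty_set I \<alpha>"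
  then obtain n where n: "n \<in> I" "1 \<le> n * \<alpha>" "n * \<alpha> < 2" "0 \<le> n"
    unfolding mem_beatty_set_iff by auto
  then have "n \<noteq> 0"
    by auto
  then have "1 \<le> n"
    using n discrete by simp
  then have "1 * \<alpha> \<le> n * \<alpha>"
    using assms by (intro mult_right_mono) auto
  then show "\<alpha> < 2"
    using n by simp
next
  assume "\<alpha> < 2"
  then show "1 \<in> beatty_set I \<alpha>"
    unfolding mem_beatty_set_iff using assms one_mem by (auto intro!: bexI[of _ 1])
qed

section \<open>Membership in terms of inverses\<close>

lemma irrational_mult_neq:
  assumes "irrational_over I \<alpha>" "u \<in> I" "v \<in> I" "u \<noteq> 0"
  shows "u * \<alpha> \<noteq> v"
proof
  assume "u * \<alpha> = v"
  then have "\<alpha> = v / u"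
    using \<open>u \<noteq> 0\<close> by (metis nonzero_mult_div_cancel_left)
  then show False
    using assms unfolding irrational_over_def frac_field_def by blast
qed

lemma beatty_hit:
  assumes irr: "irrational_over I \<alpha>" and "1 < \<alpha>" and m: "m \<in> beatty_set I \<alpha>" "m \<noteq> 0"
  shows "\<exists>s. 0 < s \<and> s < inverse \<alpha> \<and> m * inverse \<alpha> + s \<in> I"
proof -
  obtain n where n: "m \<in> I" "n \<in> I" "m \<le> n * \<alpha>" "n * \<alpha> < m + 1"
    using m unfolding mem_beatty_set_iff by blast
  have "n \<noteq> 0"
    using m n le_if_less_add_one[OF zero_mem n(1)] by auto
  then have "m < n * \<alpha>"
    using irrational_mult_neq[OF irr n(2,1)] n by auto
  then have "m * inverse \<alpha> < n" "n < (m + 1) * inverse \<alpha>"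
    using n \<open>1 < \<alpha>\<close> by (simp_all add: field_simps)
  then have "0 < n - m * inverse \<alpha>" "n - m * inverse \<alpha> < inverse \<alpha>"
    unfolding distrib_right by linarith+
  moreover have "m * inverse \<alpha> + (n - m * inverse \<alpha>) \<in> I"
    using n by simp
  ultimately show ?thesis
    by blast
qed

text \<open>
  With \<open>n = \<lfloor>m/\<alpha>\<rfloor>\<close>, a miss means that not even \<open>n + 1\<close> is below \<open>(m + 1)/\<alpha>\<close>, so that \<open>m - n\<close>
  lies between \<open>m (1 - 1/\<alpha>)\<close> and \<open>(m + 1) (1 - 1/\<alpha>)\<close>. This is the conclusion of
  \<open>beatty_hit\<close> with \<open>1 - 1/\<alpha>\<close> instead of \<open>1/\<alpha>\<close>.
\<close>

lemma beatty_miss: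
  assumes irr: "irrational_over I \<alpha>" and "1 < \<alpha>" and m: "m \<in> nonneg_part I" "m \<notin> beatty_set I \<alpha>"
  shows "\<exists>t. 0 < t \<and> t < 1 - inverse \<alpha> \<and> m * (1 - inverse \<alpha>) + t \<in> I"
proof -
  define n where "n = floor_in I (m * inverse \<alpha>)"
  have mI: "m \<in> I" "0 \<le> m"
    using m by (auto simp: nonneg_part_def)
  have n: "n \<in> I" "n \<le> m * inverse \<alpha>" "m * inverse \<alpha> < n + 1"
    unfolding n_def using floor_in[OF ip] by auto
  have n_le: "n * \<alpha> \<le> m" and less_n: "m < (n + 1) * \<alpha>"
    using n \<open>1 < \<alpha>\<close> by (auto simp: field_simps)
  have "0 \<le> n"
  proof (rule le_if_less_add_one[OF zero_mem n(1)])
    have "0 \<le> m * inverse \<alpha>"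
      using mI \<open>1 < \<alpha>\<close> by simp
    then show "0 < n + 1"
      using n by simp
  qed
  have "n * \<alpha> \<noteq> m"
    using m n \<open>0 \<le> n\<close> mI by (auto simp: mem_beatty_set_iff)
  moreover have "m + 1 \<le> (n + 1) * \<alpha>"
  proof (rule ccontr)
    assume "\<not> ?thesis"
    then have "m \<in> beatty_set I \<alpha>"
      unfolding mem_beatty_set_iff using mI n \<open>0 \<le> n\<close> less_n
      by (auto intro!: bexI[of _ "n + 1"] ring_mem)
    then show False
      using m by simp
  qed
  moreover have "(n + 1) * \<alpha> \<noteq> m + 1"
    using \<open>0 \<le> n\<close> by (intro irrational_mult_neq[OF irr]) (auto intro!: ring_mem n mI)
  ultimately have *: "n * \<alpha> < m" "m + 1 < (n + 1) * \<alpha>"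
    using n_le by auto
  have "m * (1 - inverse \<alpha>) + (m * inverse \<alpha> - n) = m - n"
    by (simp add: algebra_simps)
  then have "m * (1 - inverse \<alpha>) + (m * inverse \<alpha> - n) \<in> I"
    using diff_mem[OF mI(1) n(1)] by metis
  moreover have "n < m * inverse \<alpha>" "(m + 1) * inverse \<alpha> < n + 1"
    using * \<open>1 < \<alpha>\<close> by (simp_all add: field_simps)
  then have "0 < m * inverse \<alpha> - n" "m * inverse \<alpha> - n < 1 - inverse \<alpha>"
    unfolding distrib_right by linarith+
  ultimately show ?thesis
    by blast
qed

section \<open>Disjointness, covering and inclusion\<close>

text \<open>
  The element \<open>a s + b t = a (m p + s) + b (m q + t) - m\<close> belongs to \<open>I\<close>, and it is strictly
  between \<open>0\<close> and \<open>a p + b q = 1\<close>.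
\<close>

lemma no_simultaneous_hit:
  assumes ab: "a \<in> nonneg_part I" "b \<in> nonneg_part I" and eq: "a * p + b * q = 1"
    and "m \<in> I"
    and s: "0 < s" "s < p" "m * p + s \<in> I"
    and t: "0 < t" "t < q" "m * q + t \<in> I"
  shows False
proof -
  have ab': "a \<in> I" "b \<in> I" "0 \<le> a" "0 \<le> b"
    using ab by (auto simp: nonneg_part_def)
  have "a * s + b * t = a * (m * p + s) + b * (m * q + t) - m * (a * p + b * q)"
    by (simp add: algebra_simps)
  then have "a * s + b * t = a * (m * p + s) + b * (m * q + t) - m"
    using eq by simp
  then have mem: "a * s + b * t \<in> I"
    using ab' s t \<open>m \<in> I\<close> by (auto intro!: ring_mem)
  have nonneg: "0 \<le> a * s" "0 \<le> b * t" and le: "a * s \<le> a * p" "b * t \<le> b * q"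
    using ab' s t by (auto intro!: mult_left_mono)
  have "0 < a \<or> 0 < b"
    using ab' eq by (cases "a = 0"; cases "b = 0") auto
  then have "(0 < a * s \<and> a * s < a * p) \<or> (0 < b * t \<and> b * t < b * q)"
    using s t by auto
  then have "0 < a * s + b * t" "a * s + b * t < 1"
    using nonneg le eq by linarith+
  then show False
    using discrete[OF mem] by simp
qed

lemma beatty_disjoint:
  assumes irr: "irrational_over I \<alpha>" "irrational_over I \<beta>" and gt: "1 < \<alpha>" "1 < \<beta>"
    and ab: "a \<in> nonneg_part I" "b \<in> nonneg_part I"
    and eq: "a * inverse \<alpha> + b * inverse \<beta> = 1"
  shows "beatty_set I \<alpha> \<inter> beatty_set I \<beta> = {0}"
proof -
  have False if m: "m \<in> beatty_set I \<alpha>" "m \<in> beatty_set I \<beta>" "m \<noteq> 0" for m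
  proof -
    have "m \<in> I"
      using m by (simp add: mem_beatty_set_iff)
    obtain s where "0 < s" "s < inverse \<alpha>" "m * inverse \<alpha> + s \<in> I"
      using beatty_hit[OF irr(1) gt(1) m(1,3)] by blast
    moreover obtain t where "0 < t" "t < inverse \<beta>" "m * inverse \<beta> + t \<in> I"
      using beatty_hit[OF irr(2) gt(2) m(2,3)] by blast
    ultimately show False
      by (rule no_simultaneous_hit[OF ab eq \<open>m \<in> I\<close>])
  qed
  then show ?thesis
    using zero_mem_beatty_set[of \<alpha>] zero_mem_beatty_set[of \<beta>] by blast
qed

lemma beatty_cover:
  assumes irr: "irrational_over I \<alpha>" "irrational_over I \<beta>" and gt: "1 < \<alpha>" "1 < \<beta>"
    and ab: "a \<in> nonneg_part I" "b \<in> nonneg_part I"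
    and eq: "a * (1 - inverse \<alpha>) + b * (1 - inverse \<beta>) = 1"
  shows "beatty_set I \<alpha> \<union> beatty_set I \<beta> = nonneg_part I"
proof
  show "beatty_set I \<alpha> \<union> beatty_set I \<beta> \<subseteq> nonneg_part I"
    using gt beatty_set_subset_nonneg_part[of \<alpha>] beatty_set_subset_nonneg_part[of \<beta>] by auto
  show "nonneg_part I \<subseteq> beatty_set I \<alpha> \<union> beatty_set I \<beta>"
  proof (rule subsetI, rule ccontr)
    fix m assume m: "m \<in> nonneg_part I" and "m \<notin> beatty_set I \<alpha> \<union> beatty_set I \<beta>"
    then have notin: "m \<notin> beatty_set I \<alpha>" "m \<notin> beatty_set I \<beta>"
      by simp_all
    have "m \<in> I"
      using m by (simp add: nonneg_part_def)
    obtain s where "0 < s" "s < 1 - inverse \<alpha>" "m * (1 - inverse \<alpha>) + s \<in> I"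
      using beatty_miss[OF irr(1) gt(1) m notin(1)] by blast
    moreover obtain t where "0 < t" "t < 1 - inverse \<beta>" "m * (1 - inverse \<beta>) + t \<in> I"
      using beatty_miss[OF irr(2) gt(2) m notin(2)] by blast
    ultimately show False
      by (rule no_simultaneous_hit[OF ab eq \<open>m \<in> I\<close>])
  qed
qed

lemma beatty_subset:
  assumes irr: "irrational_over I \<alpha>" "irrational_over I \<beta>" and gt: "1 < \<alpha>" "1 < \<beta>"
    and ab: "a \<in> nonneg_part I" "b \<in> nonneg_part I"
    and eq: "a * inverse \<alpha> + b * (1 - inverse \<beta>) = 1"
  shows "beatty_set I \<alpha> \<subseteq> beatty_set I \<beta>"
proof (rule subsetI, rule ccontr)
  fix m assume m: "m \<in> beatty_set I \<alpha>" "m \<notin> beatty_set I \<beta>"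
  then have "m \<noteq> 0"
    using zero_mem_beatty_set by auto
  have m_nonneg: "m \<in> nonneg_part I"
    using m beatty_set_subset_nonneg_part[of \<alpha>] gt by auto
  then have "m \<in> I"
    by (simp add: nonneg_part_def)
  obtain s where "0 < s" "s < inverse \<alpha>" "m * inverse \<alpha> + s \<in> I"
    using beatty_hit[OF irr(1) gt(1) m(1) \<open>m \<noteq> 0\<close>] by blast
  moreover obtain t where "0 < t" "t < 1 - inverse \<beta>" "m * (1 - inverse \<beta>) + t \<in> I"
    using beatty_miss[OF irr(2) gt(2) m_nonneg m(2)] by blast
  ultimately show False
    by (rule no_simultaneous_hit[OF ab eq \<open>m \<in> I\<close>])
qed

section \<open>Coefficients of complementary pairs\<close>

lemma mult_inverse_mem_imp_zero:
  assumes irr: "irrational_over I \<beta>" and "0 < \<beta>" and "u \<in> I" "v \<in> I" and eq: "u * inverse \<beta> = v"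
  shows "u = 0"
proof (rule ccontr)
  assume "u \<noteq> 0"
  then have "v \<noteq> 0" "v * \<beta> = u"
    using eq \<open>0 < \<beta>\<close> by (auto simp: field_simps)
  then show False
    using irrational_mult_neq[OF irr] assms by blast
qed

text \<open>
  Eliminating \<open>1/\<alpha>\<close> from the two equations gives \<open>(b c - a d)/\<beta> = c - a (c + d - 1)\<close>, whose two
  sides vanish by irrationality of \<open>\<beta>\<close>. As \<open>a, c, d \<ge> 1\<close>, the equation \<open>c = a (c + d - 1)\<close> forces
  \<open>a = d = 1\<close>.
\<close>

lemma complementary_coefficients:
  assumes irr: "irrational_over I \<alpha>" "irrational_over I \<beta>" and gt: "1 < \<alpha>" "1 < \<beta>"
    and mem: "a \<in> nonneg_part I" "b \<in> nonneg_part I" "c \<in> nonneg_part I" "d \<in> nonneg_part I"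
    and eq1: "a * inverse \<alpha> + b * inverse \<beta> = 1"
    and eq2: "c * (1 - inverse \<alpha>) + d * (1 - inverse \<beta>) = 1"
  shows "a = 1" "d = 1"
proof -
  have abcd: "a \<in> I" "b \<in> I" "c \<in> I" "d \<in> I" "0 \<le> a" "0 \<le> b" "0 \<le> c" "0 \<le> d"
    using mem by (auto simp: nonneg_part_def)
  have "a \<noteq> 0"
    using mult_inverse_mem_imp_zero[OF irr(2) _ abcd(2) one_mem] eq1 gt by force
  have "c \<noteq> 0"
  proof
    assume "c = 0"
    then have "d * inverse \<beta> = d - 1"
      using eq2 by (simp add: algebra_simps)
    then have "d = 0"
      using mult_inverse_mem_imp_zero[OF irr(2)] gt abcd by (meson diff_mem one_mem less_trans zero_less_one)
    then show False
      using \<open>c = 0\<close> eq2 by simp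
  qed
  have "d \<noteq> 0"
  proof
    assume "d = 0"
    then have "c * inverse \<alpha> = c - 1"
      using eq2 by (simp add: algebra_simps)
    then have "c = 0"
      using mult_inverse_mem_imp_zero[OF irr(1)] gt abcd by (meson diff_mem one_mem less_trans zero_less_one)
    then show False
      using \<open>c \<noteq> 0\<close> by simp
  qed
  have ge: "1 \<le> a" "1 \<le> c" "1 \<le> d"
    using \<open>a \<noteq> 0\<close> \<open>c \<noteq> 0\<close> \<open>d \<noteq> 0\<close> abcd by (auto intro!: discrete)
  have eq3: "c * inverse \<alpha> + d * inverse \<beta> = c + d - 1"
    using eq2 by (simp add: algebra_simps)
  have "(c * b - a * d) * inverse \<beta>
      = c * (a * inverse \<alpha> + b * inverse \<beta>) - a * (c * inverse \<alpha> + d * inverse \<beta>)"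
    by (simp add: algebra_simps)
  then have elim: "(c * b - a * d) * inverse \<beta> = c - a * (c + d - 1)"
    unfolding eq1 eq3 by simp
  then have "c * b - a * d = 0"
    using gt abcd by (intro mult_inverse_mem_imp_zero[OF irr(2) _ _ _ elim]) (auto intro!: ring_mem)
  then have c_eq: "c = a * (c + d - 1)"
    using elim by simp
  have "1 * (c + d - 1) \<le> a * (c + d - 1)"
    using ge by (intro mult_right_mono) auto
  also have "\<dots> = c"
    using c_eq by (rule sym)
  finally show "d = 1"
    using ge by simp
  then have "a * c = 1 * c"
    using c_eq[symmetric] by simp
  then show "a = 1"
    using \<open>c \<noteq> 0\<close> by (metis mult_right_cancel)
qed

section \<open>The slope is determined by the Beatty set\<close>

text \<open>
  If \<open>n (\<beta> - \<gamma>)\<close> reaches the interval \<open>[1, \<gamma> - 1]\<close>, then \<open>n \<beta>\<close> has distance at least \<open>1\<close> from both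
  neighbours \<open>n \<gamma>\<close> and \<open>(n + 1) \<gamma>\<close>, so that \<open>\<lfloor>n \<beta>\<rfloor>\<close> is missing from \<open>N\<^sub>\<gamma>\<close>. Steps of width
  \<open>\<beta> - \<gamma>\<close> cannot jump over this interval if its length \<open>\<gamma> - 2\<close> is at least the width.
\<close>

lemma beatty_set_neq_if_close:
  assumes "0 < \<gamma>" "\<gamma> < \<beta>" and close: "\<beta> - \<gamma> \<le> \<gamma> - 2"
  shows "beatty_set I \<beta> \<noteq> beatty_set I \<gamma>"
proof
  assume same: "beatty_set I \<beta> = beatty_set I \<gamma>"
  define \<delta> where "\<delta> = \<beta> - \<gamma>"
  define n where "n = floor_in I ((\<gamma> - 1) / \<delta>)"
  have "0 < \<delta>"
    using assms by (simp add: \<delta>_def)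
  have nI: "n \<in> I" and "n \<le> (\<gamma> - 1) / \<delta>" and "(\<gamma> - 1) / \<delta> < n + 1"
    unfolding n_def using floor_in[OF ip] by auto
  then have upper: "n * \<delta> \<le> \<gamma> - 1" and "\<gamma> - 1 < n * \<delta> + \<delta>"
    using \<open>0 < \<delta>\<close> by (auto simp: field_simps)
  then have lower: "1 < n * \<delta>"
    using close by (simp add: \<delta>_def)
  then have "0 \<le> n"
    using \<open>0 < \<delta>\<close> by (metis less_trans less_imp_le zero_less_mult_pos2 zero_less_one)
  have split: "n * \<beta> = n * \<gamma> + n * \<delta>"
    by (simp add: \<delta>_def algebra_simps)
  have "floor_in I (n * \<beta>) \<in> beatty_set I \<beta>"
    unfolding beatty_set_def nonneg_part_def using nI \<open>0 \<le> n\<close> by blast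
  then have "floor_in I (n * \<beta>) \<in> beatty_set I \<gamma>"
    by (simp add: same)
  then obtain l where l: "l \<in> I" "floor_in I (n * \<beta>) \<le> l * \<gamma>" "l * \<gamma> < floor_in I (n * \<beta>) + 1"
    unfolding mem_beatty_set_iff by blast
  have near: "l * \<gamma> < n * \<beta> + 1" "n * \<beta> < l * \<gamma> + 1"
    using l floor_in[OF ip, of "n * \<beta>"] by linarith+
  show False
  proof (cases "l \<le> n")
    case True
    then have "l * \<gamma> \<le> n * \<gamma>"
      using \<open>0 < \<gamma>\<close> by (simp add: mult_right_mono)
    then show False
      using near split lower by linarith
  next
    case False
    then have "n + 1 \<le> l"
      using discrete[OF diff_mem[OF l(1) nI]] by (simp add: algebra_simps)
    then have "(n + 1) * \<gamma> \<le> l * \<gamma>"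
      using \<open>0 < \<gamma>\<close> by (simp add: mult_right_mono)
    then have "n * \<gamma> + \<gamma> \<le> l * \<gamma>"
      by (simp add: algebra_simps)
    then show False
      using near split upper by linarith
  qed
qed

text \<open>
  Comparing \<open>\<lfloor>\<gamma>\<rfloor>\<close>, the least positive element of \<open>N\<^sub>\<gamma>\<close>, with \<open>N\<^sub>\<beta>\<close> gives \<open>\<beta> < \<lfloor>\<gamma>\<rfloor> + 1\<close>. Therefore
  the slopes can only fail to be close in the sense of the previous lemma if \<open>2 \<le> \<gamma> < \<beta> < 3\<close> and
  \<open>\<beta> - 2 > 2 (\<gamma> - 2)\<close>. Let then \<open>n\<close> be least with \<open>n (\<beta> - 2) > 1\<close>. The multiples of \<open>\<beta>\<close> jump at
  \<open>n\<close> from at most \<open>2 n - 1\<close> to more than \<open>2 n + 1\<close>, thus \<open>2 n\<close> is missing from \<open>N\<^sub>\<beta>\<close>, whereas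
  \<open>n (\<gamma> - 2) < n (\<beta> - 2) / 2 \<le> (\<beta> - 1) / 2 < 1\<close> still gives \<open>\<lfloor>n \<gamma>\<rfloor> = 2 n\<close>.
\<close>

lemma beatty_set_less_neq:
  assumes "2 \<le> \<gamma>" "\<gamma> < \<beta>"
  shows "beatty_set I \<beta> \<noteq> beatty_set I \<gamma>"
proof
  assume same: "beatty_set I \<beta> = beatty_set I \<gamma>"
  have far: "\<gamma> - 2 < \<beta> - \<gamma>"
    using beatty_set_neq_if_close[of \<gamma> \<beta>] same assms by force
  define g where "g = floor_in I \<gamma>"
  have g: "g \<in> I" "g \<le> \<gamma>" "\<gamma> < g + 1"
    unfolding g_def using floor_in[OF ip] by auto
  have "g \<in> beatty_set I \<beta>"
    unfolding same mem_beatty_set_iff using g one_mem by (auto intro!: bexI[of _ 1])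
  then obtain q where q: "q \<in> I" "0 \<le> q" "g \<le> q * \<beta>" "q * \<beta> < g + 1"
    unfolding mem_beatty_set_iff by blast
  have "q \<noteq> 0"
    using q g assms by auto
  then have "1 \<le> q"
    using q by (intro discrete) auto
  then have "1 * \<beta> \<le> q * \<beta>"
    using assms by (intro mult_right_mono) auto
  then have \<beta>_less: "\<beta> < g + 1"
    using q by simp
  have "g < 1 + 1 + 1"
    using \<beta>_less g far by linarith
  then have "g \<le> 1 + 1"
    by (rule le_if_less_add_one[OF g(1) add_mem[OF one_mem one_mem]])
  then have "\<beta> < 3"
    using \<beta>_less by simp
  define n where "n = floor_in I (1 / (\<beta> - 2)) + 1"
  have "0 < \<beta> - 2"
    using assms by simp
  have nI: "n \<in> I"
    unfolding n_def using floor_in[OF ip] by (auto intro!: ring_mem)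
  have "n - 1 \<le> 1 / (\<beta> - 2)" "1 / (\<beta> - 2) < n"
    unfolding n_def using floor_in[OF ip, of "1 / (\<beta> - 2)"] by auto
  then have n_pred: "(n - 1) * (\<beta> - 2) \<le> 1" and n_above: "1 < n * (\<beta> - 2)"
    using \<open>0 < \<beta> - 2\<close> by (auto simp: field_simps)
  then have "0 < n"
    using \<open>0 < \<beta> - 2\<close> by (metis less_trans zero_less_mult_pos2 zero_less_one)
  have "n * (\<gamma> - 2) + n * (\<gamma> - 2) < n * (\<beta> - 2)"
    using far \<open>0 < n\<close> by (simp flip: distrib_left)
  moreover have "n * (\<beta> - 2) \<le> 1 + (\<beta> - 2)"
    using n_pred by (simp add: algebra_simps)
  ultimately have \<gamma>_below: "n * (\<gamma> - 2) < 1"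
    using \<open>\<beta> < 3\<close> by linarith
  have "0 \<le> n * (\<gamma> - 2)"
    using \<open>0 < n\<close> assms by simp
  then have "n + n \<le> n * \<gamma>" "n * \<gamma> < n + n + 1"
    using \<gamma>_below by (simp_all add: algebra_simps)
  then have "n + n \<in> beatty_set I \<gamma>"
    unfolding mem_beatty_set_iff using add_mem[OF nI nI] nI \<open>0 < n\<close>
    by (auto intro!: bexI[of _ n])
  then obtain r where r: "r \<in> I" "n + n \<le> r * \<beta>" "r * \<beta> < n + n + 1"
    unfolding same[symmetric] mem_beatty_set_iff by blast
  show False
  proof (cases "n \<le> r")
    case True
    then have "n * \<beta> \<le> r * \<beta>"
      using assms by (intro mult_right_mono) auto
    then show False
      using n_above r by (simp add: algebra_simps)
  next
    case False
    then have "r \<le> n - 1"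
      using discrete[OF diff_mem[OF nI r(1)]] by (simp add: algebra_simps)
    then have "r * \<beta> \<le> (n - 1) * \<beta>"
      using assms by (intro mult_right_mono) auto
    then show False
      using n_pred r by (simp add: algebra_simps)
  qed
qed

lemma beatty_set_inj:
  assumes "2 \<le> \<beta>" "2 \<le> \<gamma>" "beatty_set I \<beta> = beatty_set I \<gamma>"
  shows "\<beta> = \<gamma>"
  using assms beatty_set_less_neq by (metis linorder_neqE)

section \<open>Complementary Beatty sets\<close>

lemma complementary_inverse_sum_if_less_2:
  assumes irr: "irrational_over I \<alpha>" and "1 < \<alpha>" "\<alpha> < 2" "2 \<le> \<beta>"
    and disj: "beatty_set I \<alpha> \<inter> beatty_set I \<beta> = {0}"
    and cover: "beatty_set I \<alpha> \<union> beatty_set I \<beta> = nonneg_part I"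
  shows "inverse \<alpha> + inverse \<beta> = 1"
proof -
  define \<gamma> where "\<gamma> = inverse (1 - inverse \<alpha>)"
  have inv: "inverse \<gamma> = 1 - inverse \<alpha>"
    by (simp add: \<gamma>_def)
  have \<gamma>_eq: "\<gamma> = \<alpha> / (\<alpha> - 1)"
    using \<open>1 < \<alpha>\<close> by (simp add: \<gamma>_def field_simps)
  have "2 \<le> \<gamma>"
    unfolding \<gamma>_eq using \<open>1 < \<alpha>\<close> \<open>\<alpha> < 2\<close> by (simp add: pos_le_divide_eq)
  have "irrational_over I \<gamma>"
    unfolding irrational_over_def frac_field_def
  proof
    assume "\<gamma> \<in> {p / q |p q. p \<in> I \<and> q \<in> I \<and> q \<noteq> 0}"
    then obtain p q where pq: "\<gamma> = p / q" "p \<in> I" "q \<in> I" "q \<noteq> 0"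
      by blast
    have "p \<noteq> q"
      using pq \<open>2 \<le> \<gamma>\<close> by auto
    moreover have "\<alpha> / (\<alpha> - 1) = p / q"
      using pq \<gamma>_eq by simp
    then have "\<alpha> * q = p * (\<alpha> - 1)"
      using frac_eq_eq[of "\<alpha> - 1" q \<alpha> p] pq(4) \<open>1 < \<alpha>\<close> by simp
    then have "(p - q) * \<alpha> = p"
      by (simp add: algebra_simps)
    ultimately show False
      using irrational_mult_neq[OF irr diff_mem[OF pq(2,3)] pq(2)] by simp
  qed
  moreover have "1 < \<gamma>"
    using \<open>2 \<le> \<gamma>\<close> by simp
  moreover have "1 \<in> nonneg_part I"
    by (simp add: nonneg_part_def one_mem)
  ultimately have "beatty_set I \<alpha> \<inter> beatty_set I \<gamma> = {0}"
    and "beatty_set I \<alpha> \<union> beatty_set I \<gamma> = nonneg_part I"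
    using beatty_disjoint[OF irr _ \<open>1 < \<alpha>\<close>, of \<gamma> 1 1] beatty_cover[OF irr _ \<open>1 < \<alpha>\<close>, of \<gamma> 1 1]
    by (simp_all add: inv)
  then have "beatty_set I \<beta> = beatty_set I \<gamma>"
    using disj cover by blast
  then have "\<beta> = \<gamma>"
    using beatty_set_inj \<open>2 \<le> \<beta>\<close> \<open>2 \<le> \<gamma>\<close> by blast
  then show ?thesis
    using inv by simp
qed

lemma complementary_inverse_sum:
  assumes irr: "irrational_over I \<alpha>" "irrational_over I \<beta>" and gt: "1 < \<alpha>" "1 < \<beta>"
    and disj: "beatty_set I \<alpha> \<inter> beatty_set I \<beta> = {0}"
    and cover: "beatty_set I \<alpha> \<union> beatty_set I \<beta> = nonneg_part I"
  shows "inverse \<alpha> + inverse \<beta> = 1"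
proof -
  have "1 \<in> beatty_set I \<alpha> \<union> beatty_set I \<beta>"
    unfolding cover by (simp add: nonneg_part_def one_mem)
  moreover have "1 \<notin> beatty_set I \<alpha> \<inter> beatty_set I \<beta>"
    unfolding disj by simp
  ultimately have "1 \<in> beatty_set I \<alpha> \<longleftrightarrow> 1 \<notin> beatty_set I \<beta>"
    by blast
  then have "\<alpha> < 2 \<and> 2 \<le> \<beta> \<or> \<beta> < 2 \<and> 2 \<le> \<alpha>"
    using one_mem_beatty_set_iff gt by auto
  then show ?thesis
  proof (elim disjE conjE)
    assume "\<alpha> < 2" "2 \<le> \<beta>"
    then show ?thesis
      using complementary_inverse_sum_if_less_2[OF irr(1)] gt disj cover by blast
  next
    assume "\<beta> < 2" "2 \<le> \<alpha>"
    then have "inverse \<beta> + inverse \<alpha> = 1"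
      using complementary_inverse_sum_if_less_2[OF irr(2)] gt disj cover by (simp add: Int_commute Un_commute)
    then show ?thesis
      by (simp add: add.commute)
  qed
qed

end

section \<open>Beatty's theorem for integer parts\<close>

theorem theorem2p9:
  fixes I :: "'a::linordered_field set" and \<alpha> \<beta> a b c d :: 'a
  assumes "integer_part I"
    and "irrational_over I \<alpha>" and "irrational_over I \<beta>" and "\<alpha> \<noteq> \<beta>"
    and "\<alpha> > 1" and "\<beta> > 1"
    and "a \<in> nonneg_part I" and "b \<in> nonneg_part I"
    and "c \<in> nonneg_part I" and "d \<in> nonneg_part I"
  shows
    "(beatty_set I \<alpha> \<inter> beatty_set I \<beta> = {0} \<and> beatty_set I \<alpha> \<union> beatty_set I \<beta> = nonneg_part I
        \<longrightarrow> inverse \<alpha> + inverse \<beta> = 1) \<and>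
     (a * inverse \<alpha> + b * inverse \<beta> = 1
        \<longrightarrow> beatty_set I \<alpha> \<inter> beatty_set I \<beta> = {0}) \<and>
     (a * (1 - inverse \<alpha>) + b * (1 - inverse \<beta>) = 1
        \<longrightarrow> beatty_set I \<alpha> \<union> beatty_set I \<beta> = nonneg_part I) \<and>
     (a * inverse \<alpha> + b * (1 - inverse \<beta>) = 1
        \<longrightarrow> beatty_set I \<alpha> \<subseteq> beatty_set I \<beta>) \<and>
     (a * inverse \<alpha> + b * inverse \<beta> = 1 \<and> c * (1 - inverse \<alpha>) + d * (1 - inverse \<beta>) = 1
        \<longrightarrow> a = 1 \<and> b = 1 \<and> c = 1 \<and> d = 1 \<and> inverse \<alpha> + inverse \<beta> = 1)"
proof (intro conjI impI; (elim conjE)?)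
  note ip = assms(1) and irr = assms(2,3) and gt = assms(5,6) and ab = assms(7,8) and cd = assms(9,10)
  show "inverse \<alpha> + inverse \<beta> = 1"
    if "beatty_set I \<alpha> \<inter> beatty_set I \<beta> = {0}" "beatty_set I \<alpha> \<union> beatty_set I \<beta> = nonneg_part I"
    using complementary_inverse_sum[OF ip irr gt that] .
  show "beatty_set I \<alpha> \<inter> beatty_set I \<beta> = {0}" if "a * inverse \<alpha> + b * inverse \<beta> = 1"
    using beatty_disjoint[OF ip irr gt ab that] .
  show "beatty_set I \<alpha> \<union> beatty_set I \<beta> = nonneg_part I"
    if "a * (1 - inverse \<alpha>) + b * (1 - inverse \<beta>) = 1"
    using beatty_cover[OF ip irr gt ab that] .
  show "beatty_set I \<alpha> \<subseteq> beatty_set I \<beta>" if "a * inverse \<alpha> + b * (1 - inverse \<beta>) = 1"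
    using beatty_subset[OF ip irr gt ab that] .
  assume eq1: "a * inverse \<alpha> + b * inverse \<beta> = 1"
    and eq2: "c * (1 - inverse \<alpha>) + d * (1 - inverse \<beta>) = 1"
  have eq1': "b * inverse \<beta> + a * inverse \<alpha> = 1"
    and eq2': "d * (1 - inverse \<beta>) + c * (1 - inverse \<alpha>) = 1"
    using eq1 eq2 by (simp_all add: add.commute)
  show "a = 1" "d = 1"
    using complementary_coefficients[OF ip irr gt ab cd eq1 eq2] .
  show "b = 1" "c = 1"
    using complementary_coefficients[OF ip irr(2,1) gt(2,1) ab(2,1) cd(2,1) eq1' eq2'] .
  then show "inverse \<alpha> + inverse \<beta> = 1"
    using eq1 \<open>a = 1\<close> by simp
qed

end
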